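(* Let $\mathcal{H}$ be a separable complex Hilbert space. Let $T_0$ be a densely defined, closed, symmetric operator in $\mathcal{H}$ with deficiency indices $(1,1)$, and let $T_1$, $T_2$, $T_1\neq T_2$, be two different self-adjoint extensions of $T_0$ in $\mathcal{H}$. Let $\mathfrak{E}\subset\mathbb{R}$ be a subset that is not Lebesgue measurable, and define $$\widetilde T(t) = \begin{cases} T_1, & t\in\mathfrak{E},\\ T_2, & t\in\mathbb{R}\setminus\mathfrak{E}.\end{cases}$$ Then the family $\{\widetilde T(t)\}_{t\in\mathbb{R}}$ of self-adjoint operators is weakly measurable, but not $N$-measurable.
   Context: The scalar product $(\cdot,\cdot)_{\mathcal{H}}$ is linear in the second argument. A family of vectors $\{g(t)\}_{t\in\mathbb{R}}\subset\mathcal{H}$ is called weakly measurable if $t\mapsto (h,g(t))_{\mathcal{H}}$ is Lebesgue measurable for every $h\in\mathcal{H}$. A family $\{T(t)\}_{t\in\mathbb{R}}$ of densely defined, closed, linear operators in $\mathcal{H}$ is called weakly measurable if for every weakly measurable family of vectors $\{f(t)\}_{t\in\mathbb{R}}$ in $\mathcal{H}$ with $f(t)\in\operatorname{dom}(T(t))$ for all $t\in\mathbb{R}$, the family of vectors $\{T(t)f(t)\}_{t\in\mathbb{R}}$ is weakly measurable. For a densely defined, closed operator $T$ in $\mathcal{H}$, let $\Gamma(T)=\{\langle f,Tf\rangle : f\in\operatorname{dom}(T)\}\subseteq\mathcal{H}\oplus\mathcal{H}$ be its graph and let $P(\Gamma(T))=(P(\Gamma(T))_{j,k})_{1\le j,k\le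 2}$ be the orthogonal projection of $\mathcal{H}\oplus\mathcal{H}$ onto $\Gamma(T)$, written as a $2\times 2$ block operator matrix with entries in $\mathcal{B}(\mathcal{H})$. The family $\{T(t)\}_{t\in\mathbb{R}}$ is called $N$-measurable if for all $j,k\in\{1,2\}$ the family of bounded operators $\{P(\Gamma(T(t)))_{j,k}\}_{t\in\mathbb{R}}$ is weakly measurable (for families of bounded operators $B(t)$ this is equivalent to $t\mapsto(g,B(t)h)_{\mathcal{H}}$ being Lebesgue measurable for all $g,h\in\mathcal{H}$). *)

theory Defs
  imports "HOL-Analysis.Analysis"
begin

section \<open>Complex Hilbert spaces\<close>

class complex_vector = real_vector +
  fixes scaleC :: "complex \<Rightarrow> 'a \<Rightarrow> 'a" (infixr "*\<^sub>C" 75)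
  assumes scaleC_add_right: "c *\<^sub>C (x + y) = c *\<^sub>C x + c *\<^sub>C y"
    and scaleC_add_left: "(c + d) *\<^sub>C x = c *\<^sub>C x + d *\<^sub>C x"
    and scaleC_scaleC: "c *\<^sub>C d *\<^sub>C x = (c * d) *\<^sub>C x"
    and scaleC_one: "1 *\<^sub>C x = x"
    and scaleR_scaleC: "r *\<^sub>R x = complex_of_real r *\<^sub>C x"

global_interpretation complex_vector:
  vector_space "scaleC :: complex \<Rightarrow> 'a \<Rightarrow> 'a :: complex_vector"
  defines csubspace = complex_vector.subspace
    and cspan = complex_vector.span
    and cdim = complex_vector.dim
  by unfold_locales
    (simp_all add: scaleC_add_right scaleC_add_left scaleC_scaleC scaleC_one)

text \<open>The scalar product is linear in the second argument; positive definiteness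
  is contained in \<open>cinner_self\<close>, which also identifies the norm.\<close>

class complex_inner = complex_vector + real_normed_vector +
  fixes cinner :: "'a \<Rightarrow> 'a \<Rightarrow> complex"
  assumes cinner_commute: "cinner x y = cnj (cinner y x)"
    and cinner_add_right: "cinner x (y + z) = cinner x y + cinner x z"
    and cinner_scaleC_right: "cinner x (c *\<^sub>C y) = c * cinner x y"
    and cinner_self: "cinner x x = complex_of_real ((norm x)\<^sup>2)"

class chilbert_space = complex_inner + complete_space

text \<open>The product type is the orthogonal direct sum of Hilbert spaces: the library norm on
  pairs is already the Hilbert space norm.\<close>

instantiation prod :: (complex_vector, complex_vector) complex_vector
begin

definition scaleC_prod :: "complex \<Rightarrow> 'a \<times> 'b \<Rightarrow> 'a \<times> 'b" where
  "scaleC_prod c p = (c *\<^sub>C fst p, c *\<^sub>C snd p)"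

instance
  by intro_classes
    (simp_all add: scaleC_prod_def prod_eq_iff scaleC_add_right scaleC_add_left scaleC_scaleC
      scaleC_one scaleR_scaleC)

end

instantiation prod :: (complex_inner, complex_inner) complex_inner
begin

definition cinner_prod :: "'a \<times> 'b \<Rightarrow> 'a \<times> 'b \<Rightarrow> complex" where
  "cinner_prod p q = cinner (fst p) (fst q) + cinner (snd p) (snd q)"

instance
proof
  fix x y z :: "'a \<times> 'b" and c :: complex
  show "cinner x y = cnj (cinner y x)"
    unfolding cinner_prod_def
    by (metis cinner_commute complex_cnj_add)
  show "cinner x (y + z) = cinner x y + cinner x z"
    by (simp add: cinner_prod_def cinner_add_right)
  show "cinner x (c *\<^sub>C y) = c * cinner x y"
    by (simp add: cinner_prod_def scaleC_prod_def cinner_scaleC_right distrib_left)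
  show "cinner x x = complex_of_real ((norm x)\<^sup>2)"
    by (simp add: cinner_prod_def cinner_self norm_prod_def)
qed

end

instance prod :: (chilbert_space, chilbert_space) chilbert_space ..


section \<open>Unbounded operators\<close>

text \<open>An operator is a partial function \<open>T :: 'a \<rightharpoonup> 'a\<close> with domain \<open>dom T\<close>; its graph is the
  library's \<open>Map.graph T\<close>, and \<open>S \<subseteq>\<^sub>m T\<close> says that \<open>T\<close> extends \<open>S\<close>.\<close>

type_synonym 'a operator = "'a \<rightharpoonup> 'a"

definition linear_operator :: "'a::complex_vector operator \<Rightarrow> bool" where
  "linear_operator T \<longleftrightarrow> csubspace (dom T) \<and>
     (\<forall>f\<in>dom T. \<forall>g\<in>dom T. the (T (f + g)) = the (T f) + the (T g)) \<and>
     (\<forall>c. \<forall>f\<in>dom T. the (T (c *\<^sub>C f)) = c *\<^sub>C the (T f))"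

definition densely_defined :: "'a::complex_inner operator \<Rightarrow> bool" where
  "densely_defined T \<longleftrightarrow> closure (dom T) = UNIV"

definition closed_operator :: "'a::complex_inner operator \<Rightarrow> bool" where
  "closed_operator T \<longleftrightarrow> closed (Map.graph T)"

text \<open>Meaningful for densely defined \<open>T\<close> only, where the vector \<open>h\<close> is unique.\<close>

definition op_adjoint :: "'a::complex_inner operator \<Rightarrow> 'a operator" where
  "op_adjoint T g =
     (if \<exists>h. \<forall>f\<in>dom T. cinner g (the (T f)) = cinner h f
      then Some (THE h. \<forall>f\<in>dom T. cinner g (the (T f)) = cinner h f)
      else None)"

definition symmetric_operator :: "'a::complex_inner operator \<Rightarrow> bool" where
  "symmetric_operator T \<longleftrightarrow> linear_operator T \<and> densely_defined T \<and>
     (\<forall>f\<in>dom T. \<forall>g\<in>dom T. cinner f (the (T g)) = cinner (the (T f)) g)"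

definition self_adjoint_operator :: "'a::complex_inner operator \<Rightarrow> bool" where
  "self_adjoint_operator T \<longleftrightarrow> linear_operator T \<and> densely_defined T \<and> op_adjoint T = T"

text \<open>The library dimension is \<open>0\<close> in the infinite-dimensional case, which is sent to
  \<open>\<infinity>\<close> here.\<close>

definition ecdim :: "'a::complex_vector set \<Rightarrow> enat" where
  "ecdim S = (if \<exists>B. finite B \<and> S \<subseteq> cspan B then enat (cdim S) else \<infinity>)"

text \<open>The pair of dimensions of \<open>ker (T* - i)\<close> and \<open>ker (T* + i)\<close>.\<close>

definition deficiency_indices :: "'a::complex_inner operator \<Rightarrow> enat \<times> enat" where
  "deficiency_indices T =
     (ecdim {f. op_adjoint T f = Some (\<i> *\<^sub>C f)},
      ecdim {f. op_adjoint T f = Some ((- \<i>) *\<^sub>C f)})"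


section \<open>Weak measurability and N-measurability\<close>

definition weakly_measurable_vectors :: "(real \<Rightarrow> 'a::complex_inner) \<Rightarrow> bool" where
  "weakly_measurable_vectors g \<longleftrightarrow> (\<forall>h. (\<lambda>t. cinner h (g t)) \<in> borel_measurable lebesgue)"

definition weakly_measurable_operators :: "(real \<Rightarrow> 'a::complex_inner operator) \<Rightarrow> bool" where
  "weakly_measurable_operators T \<longleftrightarrow>
     (\<forall>f. weakly_measurable_vectors f \<longrightarrow> (\<forall>t. f t \<in> dom (T t)) \<longrightarrow>
        weakly_measurable_vectors (\<lambda>t. the (T t (f t))))"

text \<open>Well-defined for closed linear subspaces \<open>M\<close> of a Hilbert space.\<close>

definition orth_projection :: "'a::complex_inner set \<Rightarrow> 'a \<Rightarrow> 'a" where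
  "orth_projection M x = (THE y. y \<in> M \<and> (\<forall>z\<in>M. cinner z (x - y) = 0))"

text \<open>The \<open>(j,k)\<close> entry, \<open>j, k \<in> {1,2}\<close>, of an operator on the direct sum as a block matrix:
  embed into the \<open>k\<close>-th summand, apply the operator, take the \<open>j\<close>-th component.\<close>

definition block_entry ::
    "('a::complex_inner \<times> 'a \<Rightarrow> 'a \<times> 'a) \<Rightarrow> nat \<Rightarrow> nat \<Rightarrow> 'a \<Rightarrow> 'a" where
  "block_entry P j k h =
     (if j = 1 then fst else snd) (P (if k = 1 then (h, 0) else (0, h)))"

definition N_measurable :: "(real \<Rightarrow> 'a::complex_inner operator) \<Rightarrow> bool" where
  "N_measurable T \<longleftrightarrow>
     (\<forall>j\<in>{1,2}. \<forall>k\<in>{1,2}.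
        weakly_measurable_operators
          (\<lambda>t h. Some (block_entry (orth_projection (Map.graph (T t))) j k h)))"

end

(*
Weak measurability: if h lies in dom T0, then (h, T(t) f(t)) = (T0 h, f(t)) whichever of the two
self-adjoint extensions T(t) is, and this is measurable in t. Since dom T0 is dense, every other h
follows by a pointwise limit. No N-measurability: each matrix element of P(Gamma(T(t))) takes one
value on E and another off E, so its measurability forces the two values to coincide. If this
happened for all matrix elements, the projections onto the closed graphs of T1 and T2 would agree,
and hence T1 = T2.
*)
theory Submission
  imports Defs
begin

section \<open>Inner products and orthogonal projections\<close>

lemma cinner_add_left: "cinner (x + y) z = cinner x z + cinner y (z::'a::complex_inner)"
  by (metis cinner_commute cinner_add_right complex_cnj_add)

lemma cinner_scaleC_left: "cinner (c *\<^sub>C x) y = cnj c * cinner x (y::'a::complex_inner)"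
  by (metis cinner_commute cinner_scaleC_right complex_cnj_mult)

lemma cinner_zero_right [simp]: "cinner x (0::'a::complex_inner) = 0"
  using cinner_add_right[of x 0 0] by simp

lemma cinner_zero_left [simp]: "cinner (0::'a::complex_inner) x = 0"
  using cinner_add_left[of 0 0 x] by simp

lemma cinner_diff_right: "cinner x (y - z) = cinner x y - cinner x (z::'a::complex_inner)"
  using cinner_add_right[of x "y - z" z] by simp

lemma cinner_diff_left: "cinner (x - y) z = cinner x z - cinner y (z::'a::complex_inner)"
  using cinner_add_left[of "x - y" y z] by simp

lemma cinner_eq_zero_iff: "cinner x x = 0 \<longleftrightarrow> x = (0::'a::complex_inner)"
  by (simp add: cinner_self)

lemma cinner_eqI: "x = (y::'a::complex_inner)" if "\<And>z. cinner z x = cinner z y"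
  using that[of "x - y"] cinner_eq_zero_iff[of "x - y"] by (simp add: cinner_diff_right)

lemma norm_add_sq:
  "(norm (x + y))\<^sup>2 = (norm x)\<^sup>2 + 2 * Re (cinner x y) + (norm (y::'a::complex_inner))\<^sup>2"
proof -
  have "cinner (x + y) (x + y) = cinner x x + (cinner x y + cnj (cinner x y)) + cinner y y"
    using cinner_commute[of y x] by (simp add: cinner_add_left cinner_add_right)
  then have "Re (cinner (x + y) (x + y))
      = Re (cinner x x + (cinner x y + cnj (cinner x y)) + cinner y y)"
    by (rule arg_cong)
  then show ?thesis
    by (simp add: cinner_self del: of_real_power)
qed

lemma norm_diff_sq:
  "(norm (x - y))\<^sup>2 = (norm x)\<^sup>2 - 2 * Re (cinner x y) + (norm (y::'a::complex_inner))\<^sup>2"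
  using norm_add_sq[of x "- y"] cinner_diff_right[of x 0 y] by simp

lemma parallelogram_law:
  "(norm (x + y))\<^sup>2 + (norm (x - y))\<^sup>2 = 2 * (norm x)\<^sup>2 + 2 * (norm (y::'a::complex_inner))\<^sup>2"
  by (simp add: norm_add_sq norm_diff_sq)

text \<open>By polarisation, continuity of the norm gives continuity of the scalar product.\<close>

lemma continuous_on_cinner_left: "continuous_on UNIV (\<lambda>x. cinner x (y::'a::complex_inner))"
proof -
  have Re: "Re (cinner x z) = ((norm (x + z))\<^sup>2 - (norm (x - z))\<^sup>2) / 4" for x z :: 'a
    by (simp add: norm_add_sq norm_diff_sq)
  \<comment> \<open>By linearity in the second argument, \<open>cinner x (\<i> *\<^sub>C y)\<close>
    is \<open>\<i> * cinner x y\<close>, whose real part is minus the imaginary part of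
    \<open>cinner x y\<close>; hence the minus sign.\<close>
  have "cinner x y = complex_of_real (Re (cinner x y)) - \<i> * complex_of_real (Re (cinner x (\<i> *\<^sub>C y)))"
    for x by (simp add: cinner_scaleC_right complex_eq_iff)
  then have "cinner x y = complex_of_real (((norm (x + y))\<^sup>2 - (norm (x - y))\<^sup>2) / 4)
      - \<i> * complex_of_real (((norm (x + \<i> *\<^sub>C y))\<^sup>2 - (norm (x - \<i> *\<^sub>C y))\<^sup>2) / 4)" for x
    by (simp only: Re)
  then show ?thesis
    by (simp only:) (intro continuous_intros, auto)
qed

lemma tendsto_cinner_left:
  "(f \<longlongrightarrow> l) F \<Longrightarrow> ((\<lambda>n. cinner (f n) y) \<longlongrightarrow> cinner l (y::'a::complex_inner)) F"
  using continuous_on_tendsto_compose[OF continuous_on_cinner_left] by fastforce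

text \<open>The projection theorem by minimal distance: a minimising sequence in \<open>M\<close> is
  Cauchy by the parallelogram law, its limit attains the distance, and a residual not orthogonal to
  some \<open>z\<close> in \<open>M\<close> could be shortened by a step along
  \<open>z\<close>.\<close>

lemma closed_subspace_projection_exists:
  fixes M :: "'a::chilbert_space set"
  assumes sub: "csubspace M" and cl: "closed M"
  shows "\<exists>y\<in>M. \<forall>z\<in>M. cinner z (x - y) = 0"
proof -
  have ne: "M \<noteq> {}" using complex_vector.subspace_0[OF sub] by blast
  define d where "d = infdist x M"
  have d_le: "d \<le> norm (x - y)" if "y \<in> M" for y
    using infdist_le[OF that, of x] by (simp add: d_def dist_norm)
  have d0: "0 \<le> d" by (simp add: d_def infdist_nonneg)
  have "\<exists>y\<in>M. norm (x - y) < d + 1 / real (Suc n)" for n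
  proof (rule ccontr)
    assume "\<not> ?thesis"
    then have "d + 1 / real (Suc n) \<le> infdist x M"
      unfolding infdist_notempty[OF ne] using ne
      by (intro cINF_greatest) (auto simp: dist_norm not_less)
    then show False by (simp add: d_def)
  qed
  then obtain y where yM: "\<And>n. y n \<in> M" and y: "\<And>n. norm (x - y n) < d + 1 / real (Suc n)"
    by metis
  have lim: "(\<lambda>n. norm (x - y n)) \<longlonglongrightarrow> d"
  proof (rule tendsto_sandwich[where f = "\<lambda>_. d"])
    show "(\<lambda>n. d + 1 / real (Suc n)) \<longlonglongrightarrow> d"
      using tendsto_add[OF tendsto_const LIMSEQ_Suc[OF lim_1_over_n]] by fastforce
    show "\<forall>\<^sub>F n in sequentially. norm (x - y n) \<le> d + 1 / real (Suc n)"
      using y by (simp add: less_imp_le)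
  qed (use d_le yM in auto)
  \<comment> \<open>The midpoint of \<open>y m\<close> and \<open>y n\<close> lies in
    \<open>M\<close>, so its distance from \<open>x\<close> is at least \<open>d\<close>. This
    bounds the sum term in the parallelogram law for \<open>x - y m\<close> and
    \<open>x - y n\<close> from below by \<open>4 * d\<^sup>2\<close>.\<close>
  have pl: "(norm (y m - y n))\<^sup>2 \<le> 2 * (norm (x - y m))\<^sup>2 + 2 * (norm (x - y n))\<^sup>2 - 4 * d\<^sup>2" for m n
  proof -
    have "(1/2) *\<^sub>R (y m + y n) \<in> M"
      unfolding scaleR_scaleC
      using yM sub by (intro complex_vector.subspace_scale complex_vector.subspace_add)
    then have "2 * d \<le> 2 * norm (x - (1/2) *\<^sub>R (y m + y n))" using d_le by simp
    also have "\<dots> = norm (2 *\<^sub>R (x - (1/2) *\<^sub>R (y m + y n)))" by simp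
    also have "2 *\<^sub>R (x - (1/2) *\<^sub>R (y m + y n)) = (x - y m) + (x - y n)"
      by (simp add: scaleR_diff_right scaleR_2)
    finally have "(2 * d)\<^sup>2 \<le> (norm ((x - y m) + (x - y n)))\<^sup>2"
      using d0 by (intro power_mono) auto
    then show ?thesis
      using parallelogram_law[of "x - y m" "x - y n"] by (simp add: norm_minus_commute)
  qed
  have "Cauchy y"
  proof (rule metric_CauchyI)
    fix e :: real assume e: "0 < e"
    have "(\<lambda>n. (norm (x - y n))\<^sup>2) \<longlonglongrightarrow> d\<^sup>2" by (intro tendsto_intros lim)
    \<comment> \<open>The slack of a quarter is chosen for \<open>pl\<close>: two terms with factor
      2 add up to exactly \<open>e\<^sup>2\<close> after \<open>4 * d\<^sup>2\<close>
      cancels.\<close>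
    moreover have "d\<^sup>2 < d\<^sup>2 + e\<^sup>2 / 4" using e by simp
    ultimately have "\<forall>\<^sub>F n in sequentially. (norm (x - y n))\<^sup>2 < d\<^sup>2 + e\<^sup>2 / 4"
      by (rule order_tendstoD(2))
    then obtain N where N: "\<And>n. n \<ge> N \<Longrightarrow> (norm (x - y n))\<^sup>2 < d\<^sup>2 + e\<^sup>2 / 4"
      by (auto simp: eventually_sequentially)
    have "dist (y m) (y n) < e" if "m \<ge> N" "n \<ge> N" for m n
    proof -
      have "(norm (y m - y n))\<^sup>2 < e\<^sup>2"
        using pl[of m n] N[OF that(1)] N[OF that(2)] by linarith
      then show ?thesis using e by (simp add: dist_norm power2_less_imp_less)
    qed
    then show "\<exists>N. \<forall>m\<ge>N. \<forall>n\<ge>N. dist (y m) (y n) < e" by blast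
  qed
  then obtain l where l: "y \<longlonglongrightarrow> l" using Cauchy_convergent convergent_def by blast
  have lM: "l \<in> M" using closed_sequentially[OF cl] yM l by blast
  have "(\<lambda>n. norm (x - y n)) \<longlonglongrightarrow> norm (x - l)" by (intro tendsto_intros l)
  then have d_eq: "norm (x - l) = d" using lim LIMSEQ_unique by blast
  have "cinner z (x - l) = 0" if z: "z \<in> M" for z
  proof (rule ccontr)
    define a where "a = cinner (x - l) z"
    assume "cinner z (x - l) \<noteq> 0"
    then have a0: "a \<noteq> 0" unfolding a_def by (metis cinner_commute complex_cnj_zero)
    \<comment> \<open>The factor \<open>cnj a\<close> in \<open>c\<close> makes \<open>c * a\<close>
      real and positive. Moving \<open>l\<close> by \<open>c *\<^sub>C z\<close> changes the squared
      distance by \<open>r * (norm a)\<^sup>2\<close> times \<open>r * (norm z)\<^sup>2 - 2\<close>;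
      this choice of \<open>r\<close> keeps \<open>r * (norm z)\<^sup>2\<close> below 1, so the
      change is negative, contradicting minimality.\<close>
    define r where "r = 1 / (1 + (norm z)\<^sup>2)"
    define c where "c = complex_of_real r * cnj a"
    have r: "0 < r" "r * (norm z)\<^sup>2 < 1" by (auto simp: r_def add_pos_nonneg field_simps)
    have ca: "c * a = complex_of_real (r * (norm a)\<^sup>2)"
      using complex_norm_square[of a] by (simp add: c_def mult.commute mult.left_commute)
    have "(norm (c *\<^sub>C z))\<^sup>2 = Re (cinner (c *\<^sub>C z) (c *\<^sub>C z))" by (simp add: cinner_self del: of_real_power)
    also have "\<dots> = Re (cnj c * c * cinner z z)"
      by (simp only: cinner_scaleC_left cinner_scaleC_right mult.assoc mult.left_commute)
    also have "cnj c * c * cinner z z = complex_of_real ((norm c)\<^sup>2 * (norm z)\<^sup>2)"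
      using complex_norm_square[of c] by (simp add: cinner_self mult.commute)
    finally have nc: "(norm (c *\<^sub>C z))\<^sup>2 = (norm c)\<^sup>2 * (norm z)\<^sup>2" by simp
    have "(norm c)\<^sup>2 = r\<^sup>2 * (norm a)\<^sup>2" by (simp add: c_def norm_mult power_mult_distrib)
    with nc have nc: "(norm (c *\<^sub>C z))\<^sup>2 = r * (norm a)\<^sup>2 * (r * (norm z)\<^sup>2)"
      by (simp add: power2_eq_square)
    have pos: "0 < r * (norm a)\<^sup>2" using r a0 by simp
    have "l + c *\<^sub>C z \<in> M"
      using sub lM z by (intro complex_vector.subspace_scale complex_vector.subspace_add)
    then have "d\<^sup>2 \<le> (norm (x - (l + c *\<^sub>C z)))\<^sup>2" using d_le d0 by (intro power_mono)
    also have "x - (l + c *\<^sub>C z) = (x - l) - c *\<^sub>C z" by simp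
    also have "(norm \<dots>)\<^sup>2 = d\<^sup>2 - 2 * (r * (norm a)\<^sup>2) + r * (norm a)\<^sup>2 * (r * (norm z)\<^sup>2)"
      unfolding norm_diff_sq d_eq nc cinner_scaleC_right a_def[symmetric] ca by simp
    finally have "2 * (r * (norm a)\<^sup>2) \<le> r * (norm a)\<^sup>2 * (r * (norm z)\<^sup>2)" by simp
    also have "\<dots> < r * (norm a)\<^sup>2 * 1" using pos r(2) by (rule mult_strict_left_mono[rotated])
    finally show False using pos by simp
  qed
  with lM show ?thesis by blast
qed

text \<open>Uniqueness, which resolves the definite description: the difference of two candidates
  lies in \<open>M\<close> and is orthogonal to both residuals, hence to itself.\<close>

lemma orth_projection_eqI:
  fixes M :: "'a::complex_inner set"
  assumes sub: "csubspace M" and y: "y \<in> M" "\<forall>z\<in>M. cinner z (x - y) = 0"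
  shows "orth_projection M x = y"
  unfolding orth_projection_def
proof (rule the_equality)
  fix y' assume y': "y' \<in> M \<and> (\<forall>z\<in>M. cinner z (x - y') = 0)"
  have "y' - y \<in> M" using complex_vector.subspace_diff[OF sub] y y' by blast
  then have "cinner (y' - y) (x - y) = 0" "cinner (y' - y) (x - y') = 0" using y y' by auto
  then have "cinner (y' - y) (y' - y) = 0" by (simp add: cinner_diff_right)
  then show "y' = y" by (simp add: cinner_eq_zero_iff)
qed (use y in blast)

lemma orth_projection:
  fixes M :: "'a::chilbert_space set"
  assumes "csubspace M" "closed M"
  shows "orth_projection M x \<in> M" "z \<in> M \<Longrightarrow> cinner z (x - orth_projection M x) = 0"
  using closed_subspace_projection_exists[OF assms, of x] orth_projection_eqI[OF assms(1)] by metis+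

lemma orth_projection_ident:
  "csubspace M \<Longrightarrow> x \<in> M \<Longrightarrow> orth_projection M x = (x::'a::complex_inner)"
  by (simp add: orth_projection_eqI)

text \<open>Serves to split the projection of a pair into the contributions of its two components,
  which is what the block entries record.\<close>

lemma orth_projection_add:
  fixes M :: "'a::chilbert_space set"
  assumes M: "csubspace M" "closed M"
  shows "orth_projection M (x + y) = orth_projection M x + orth_projection M y"
proof (rule orth_projection_eqI[OF M(1)])
  show "orth_projection M x + orth_projection M y \<in> M"
    using M by (intro complex_vector.subspace_add orth_projection)
  have "cinner z (x - orth_projection M x) + cinner z (y - orth_projection M y) = 0" if "z \<in> M" for z
    using orth_projection(2)[OF M that] by simp
  then show "\<forall>z\<in>M. cinner z (x + y - (orth_projection M x + orth_projection M y)) = 0"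
    by (simp add: cinner_add_right[symmetric] algebra_simps)
qed

text \<open>The entries of column 1 determine the projection on pairs \<open>(u, 0)\<close>, those
  of column 2 on pairs \<open>(0, v)\<close>, so by additivity the two projections agree everywhere.
  A point of \<open>M\<close> is fixed by the projection onto \<open>M\<close>, hence is a value of
  the projection onto \<open>N\<close>.\<close>

lemma subset_if_block_entries_eq:
  fixes M N :: "('a::chilbert_space \<times> 'a) set"
  assumes M: "csubspace M" "closed M" and N: "csubspace N" "closed N"
    and eq: "\<And>j k h. j \<in> {1,2} \<Longrightarrow> k \<in> {1,2} \<Longrightarrow>
      block_entry (orth_projection M) j k h = block_entry (orth_projection N) j k h"
  shows "M \<subseteq> N"
proof
  fix p assume p: "p \<in> M"
  obtain u v where uv: "p = (u, 0) + (0, v)" by (cases p) auto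
  have "orth_projection M (u, 0) = orth_projection N (u, 0)"
    using eq[of 1 1 u] eq[of 2 1 u] by (simp add: block_entry_def prod_eq_iff)
  moreover have "orth_projection M (0, v) = orth_projection N (0, v)"
    using eq[of 1 2 v] eq[of 2 2 v] by (simp add: block_entry_def prod_eq_iff)
  ultimately have "orth_projection N p = orth_projection M p"
    unfolding uv by (simp only: orth_projection_add[OF M] orth_projection_add[OF N])
  then show "p \<in> N"
    using orth_projection_ident[OF M(1) p] orth_projection(1)[OF N, of p] by simp
qed

section \<open>Self-adjoint operators\<close>

text \<open>The vector \<open>h - k\<close> is orthogonal to the domain and is a limit of domain
  vectors, so it is orthogonal to itself. This gives uniqueness of the vector in the definition of
  the adjoint.\<close>

lemma cinner_eq_on_dense:
  assumes dense: "densely_defined T" and eq: "\<And>f. f \<in> dom T \<Longrightarrow> cinner h f = cinner k f"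
  shows "h = (k::'a::complex_inner)"
proof -
  have "h - k \<in> closure (dom T)" using dense by (simp add: densely_defined_def)
  then obtain s where s: "\<And>n. s n \<in> dom T" "s \<longlonglongrightarrow> h - k" by (auto simp: closure_sequential)
  have "cinner (s n) (h - k) = 0" for n
    using eq[OF s(1)] cinner_commute[of "s n"] by (simp add: cinner_diff_right)
  then have "cinner (h - k) (h - k) = 0"
    using tendsto_cinner_left[OF s(2), of "h - k"] by (simp add: LIMSEQ_const_iff)
  then show ?thesis by (simp add: cinner_eq_zero_iff)
qed

lemma op_adjoint_eq_Some_iff:
  fixes T :: "'a::complex_inner operator"
  assumes dense: "densely_defined T"
  shows "op_adjoint T g = Some h \<longleftrightarrow> (\<forall>f\<in>dom T. cinner g (the (T f)) = cinner h f)"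
proof -
  have *: "(THE h. \<forall>f\<in>dom T. cinner g (the (T f)) = cinner h f) = k"
    if "\<forall>f\<in>dom T. cinner g (the (T f)) = cinner k f" for k
  proof (rule the_equality)
    fix h assume h: "\<forall>f\<in>dom T. cinner g (the (T f)) = cinner h f"
    show "h = k"
      by (rule cinner_eq_on_dense[OF dense]) (use h that in metis)
  qed (fact that)
  show ?thesis
  proof
    assume "op_adjoint T g = Some h"
    then show "\<forall>f\<in>dom T. cinner g (the (T f)) = cinner h f"
      using * by (auto simp: op_adjoint_def split: if_splits)
  next
    assume "\<forall>f\<in>dom T. cinner g (the (T f)) = cinner h f"
    then show "op_adjoint T g = Some h"
      using *[of h] by (auto simp: op_adjoint_def)
  qed
qed

text \<open>Since \<open>T\<close> equals its adjoint, membership in its graph becomes a family of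
  scalar equations; symmetry and closedness are both read off from it.\<close>

lemma self_adjoint_eq_Some_iff:
  "self_adjoint_operator T \<Longrightarrow> T g = Some h \<longleftrightarrow> (\<forall>f\<in>dom T. cinner g (the (T f)) = cinner h f)"
  using op_adjoint_eq_Some_iff[of T g h] by (simp add: self_adjoint_operator_def)

lemma self_adjoint_symmetric:
  assumes "self_adjoint_operator T" "g \<in> dom T" "f \<in> dom T"
  shows "cinner g (the (T f)) = cinner (the (T g)) f"
  using self_adjoint_eq_Some_iff[OF assms(1), of g "the (T g)"] assms(2,3) by auto

text \<open>The graph is cut out by equations between scalar products that are continuous in the
  pair, so they survive passage to the limit.\<close>

lemma closed_graph_self_adjoint:
  assumes sa: "self_adjoint_operator T"
  shows "closed (Map.graph T)"
proof (rule closed_sequential_limits[THEN iffD2], intro allI impI, elim conjE)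
  fix s l assume s: "\<forall>n. s n \<in> Map.graph T" and lim: "s \<longlonglongrightarrow> l"
  have "T (fst (s n)) = Some (snd (s n))" for n
    using s[rule_format, of n] by (auto simp: Map.graph_def)
  then have eq: "cinner (fst (s n)) (the (T f)) = cinner (snd (s n)) f" if "f \<in> dom T" for f n
    using self_adjoint_eq_Some_iff[OF sa] that by blast
  have "cinner (fst l) (the (T f)) = cinner (snd l) f" if f: "f \<in> dom T" for f
  proof (rule LIMSEQ_unique)
    show "(\<lambda>n. cinner (fst (s n)) (the (T f))) \<longlonglongrightarrow> cinner (fst l) (the (T f))"
      by (intro tendsto_cinner_left tendsto_fst lim)
    show "(\<lambda>n. cinner (fst (s n)) (the (T f))) \<longlonglongrightarrow> cinner (snd l) f"
      unfolding eq[OF f] by (intro tendsto_cinner_left tendsto_snd lim)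
  qed
  then have "T (fst l) = Some (snd l)" using self_adjoint_eq_Some_iff[OF sa] by blast
  then show "l \<in> Map.graph T" by (auto simp: Map.graph_def intro: prod_eqI)
qed

lemma csubspace_graph:
  assumes T: "linear_operator T"
  shows "csubspace (Map.graph T)"
proof (rule complex_vector.subspaceI)
  have sub: "csubspace (dom T)" using T by (simp add: linear_operator_def)
  have gr: "p \<in> Map.graph T \<longleftrightarrow> fst p \<in> dom T \<and> snd p = the (T (fst p))" for p
    by (cases p) (auto simp: Map.graph_def)
  have z: "0 \<in> dom T" by (rule complex_vector.subspace_0[OF sub])
  \<comment> \<open>Additivity at \<open>0 + 0\<close> forces the value at 0 to be 0.\<close>
  then have "the (T (0 + 0)) = the (T 0) + the (T 0)" using T unfolding linear_operator_def by blast
  then show "0 \<in> Map.graph T" using z by (simp add: gr)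
  fix p q assume "p \<in> Map.graph T" "q \<in> Map.graph T"
  then show "p + q \<in> Map.graph T"
    using T complex_vector.subspace_add[OF sub] by (simp add: gr linear_operator_def)
next
  fix c p assume p: "p \<in> Map.graph T"
  have sub: "csubspace (dom T)" using T by (simp add: linear_operator_def)
  from p show "c *\<^sub>C p \<in> Map.graph T"
    using T complex_vector.subspace_scale[OF sub]
    by (cases p) (auto simp: Map.graph_def scaleC_prod_def linear_operator_def dom_def, metis option.sel)
qed

section \<open>Measurability\<close>

text \<open>The dependence of \<open>T t\<close> on \<open>t\<close> may be arbitrary: tested
  against \<open>g\<close> in \<open>dom S\<close>, the operator moves to the other side, where only
  the fixed vector \<open>the (S g)\<close> remains.\<close>

lemma weakly_measurable_if_common_restriction:
  fixes S :: "'a::complex_inner operator"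
  assumes dense: "densely_defined S" and sa: "\<And>t. self_adjoint_operator (T t)"
    and ext: "\<And>t. S \<subseteq>\<^sub>m T t"
  shows "weakly_measurable_operators T"
  unfolding weakly_measurable_operators_def
proof (intro allI impI)
  fix f assume f: "weakly_measurable_vectors f" and d: "\<forall>t. f t \<in> dom (T t)"
  have base: "(\<lambda>t. cinner g (the (T t (f t)))) \<in> borel_measurable lebesgue" if g: "g \<in> dom S" for g
  proof -
    have "cinner g (the (T t (f t))) = cinner (the (S g)) (f t)" for t
    proof -
      have Sg: "T t g = S g" using ext[of t] g unfolding map_le_def by simp
      then have "g \<in> dom (T t)" using g by auto
      then show ?thesis using self_adjoint_symmetric[OF sa[of t]] d Sg by metis
    qed
    then show ?thesis using f by (simp add: weakly_measurable_vectors_def)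
  qed
  show "weakly_measurable_vectors (\<lambda>t. the (T t (f t)))"
    unfolding weakly_measurable_vectors_def
  proof
    fix h
    have "h \<in> closure (dom S)" using dense by (simp add: densely_defined_def)
    then obtain s where s: "\<And>n. s n \<in> dom S" "s \<longlonglongrightarrow> h" by (auto simp: closure_sequential)
    show "(\<lambda>t. cinner h (the (T t (f t)))) \<in> borel_measurable lebesgue"
    \<comment> \<open>For each fixed \<open>t\<close> the scalar products with \<open>s n\<close>
      converge to the one with \<open>h\<close>, so measurability passes to the limit.\<close>
    proof (rule borel_measurable_LIMSEQ_metric)
      show "(\<lambda>t. cinner (s n) (the (T t (f t)))) \<in> borel_measurable lebesgue" for n
        by (rule base[OF s(1)])
    qed (rule tendsto_cinner_left[OF s(2)])
  qed
qed

text \<open>If the values differed, the preimage of the singleton \<open>{a}\<close> would be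
  exactly \<open>E\<close>; in a T1 space this singleton is closed, hence Borel.\<close>

lemma piecewise_constant_not_measurable:
  fixes a b :: "'b::t1_space"
  assumes meas: "(\<lambda>t. if t \<in> E then a else b) \<in> borel_measurable M"
    and E: "E \<subseteq> space M" "E \<notin> sets M"
  shows "a = b"
proof (rule ccontr)
  assume "a \<noteq> b"
  then have "(\<lambda>t. if t \<in> E then a else b) -` {a} \<inter> space M = E" using E(1) by auto
  then show False using measurable_sets[OF meas, of "{a}"] E(2) by simp
qed

theorem mainTheorem3:
  fixes T0 T1 T2 :: "'a::chilbert_space operator"
    and E :: "real set"
    and T :: "real \<Rightarrow> 'a operator"
  assumes separable: "separable_space (euclidean :: 'a topology)"
    and T0: "densely_defined T0" "closed_operator T0" "symmetric_operator T0"
    and deficiency: "deficiency_indices T0 = (1, 1)"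
    and T1: "self_adjoint_operator T1" "T0 \<subseteq>\<^sub>m T1"
    and T2: "self_adjoint_operator T2" "T0 \<subseteq>\<^sub>m T2"
    and neq: "T1 \<noteq> T2"
    and E: "E \<notin> sets lebesgue"
    and T_def: "\<And>t. T t = (if t \<in> E then T1 else T2)"
  shows "(\<forall>t. self_adjoint_operator (T t)) \<and>
         weakly_measurable_operators T \<and> \<not> N_measurable T"
proof (intro conjI)
  show sa: "\<forall>t. self_adjoint_operator (T t)" using T1 T2 T_def by simp
  show "weakly_measurable_operators T"
    using weakly_measurable_if_common_restriction[OF T0(1), of T] sa T1(2) T2(2) T_def by simp
  show "\<not> N_measurable T"
  proof
    assume N: "N_measurable T"
    let ?P1 = "orth_projection (Map.graph T1)" and ?P2 = "orth_projection (Map.graph T2)"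
    have eq: "block_entry ?P1 j k h = block_entry ?P2 j k h" if jk: "j \<in> {1,2}" "k \<in> {1,2}" for j k h
    proof (rule cinner_eqI)
      fix g
      let ?B = "\<lambda>t. block_entry (orth_projection (Map.graph (T t))) j k h"
      have "weakly_measurable_operators
          (\<lambda>t h. Some (block_entry (orth_projection (Map.graph (T t))) j k h))"
        using N jk unfolding N_measurable_def by blast
      \<comment> \<open>Block entries are total, so a constant family is an admissible test family;
        it turns weak measurability of operators into measurability of single matrix
        elements.\<close>
      moreover have "weakly_measurable_vectors (\<lambda>t. h)"
        by (simp add: weakly_measurable_vectors_def)
      ultimately have "weakly_measurable_vectors ?B"
        unfolding weakly_measurable_operators_def by fastforce
      then have "(\<lambda>t. cinner g (?B t)) \<in> borel_measurable lebesgue"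
        unfolding weakly_measurable_vectors_def by blast
      also have "(\<lambda>t. cinner g (?B t)) = (\<lambda>t. if t \<in> E
          then cinner g (block_entry ?P1 j k h) else cinner g (block_entry ?P2 j k h))"
        by (auto simp: T_def)
      finally show "cinner g (block_entry ?P1 j k h) = cinner g (block_entry ?P2 j k h)"
        by (rule piecewise_constant_not_measurable) (use E in auto)
    qed
    have sub: "csubspace (Map.graph T1)" "csubspace (Map.graph T2)"
      using T1(1) T2(1) csubspace_graph by (auto simp: self_adjoint_operator_def)
    note cl = closed_graph_self_adjoint[OF T1(1)] closed_graph_self_adjoint[OF T2(1)]
    have "Map.graph T1 = Map.graph T2"
      using subset_if_block_entries_eq[OF sub(1) cl(1) sub(2) cl(2)]
        subset_if_block_entries_eq[OF sub(2) cl(2) sub(1) cl(1)] eq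
      by (metis subset_antisym)
    \<comment> \<open>A partial function is recovered from its graph, including where it is
      undefined.\<close>
    then have "T1 x = Some y \<longleftrightarrow> T2 x = Some y" for x y
      by (auto simp: Map.graph_def set_eq_iff)
    then have "T1 = T2" by (metis option.exhaust ext)
    with neq show False ..
  qed
qed

end
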